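(* Assume the non-smooth setting, i.e. a subgradient mapping $g(y)\in\partial f(y)$, $y\in Q$, is given and $l_f(y;x):=f(y)+\langle g(y),x-y\rangle$. Let weight parameters $\{\lambda_k\}_{k\ge0}$ and scaling parameters $\{\beta_k\}_{k\ge-1}$ be given. (a) For any sequence $\{(z_{k-1},x_k,g_k,\hat x_k)\}_{k\ge0}$ generated by procedure (a) of the general subgradient-based method (Method 1), we have for all $k\ge0$ $$f(\hat x_k)-f(x^* )\le\frac{1}{S_k}\sum_{i=0}^k\lambda_if(x_i)-f(x^* )\le\frac{\beta_kl_d(z_k;x^* )+\frac{1}{2\sigma}\sum_{i=0}^k\frac{\lambda_i^2}{\beta_{i-1}}\|g_i\|_*^2}{S_k}.$$ (b) For any sequence $\{(z_{k-1},x_k,g_k,\hat x_k)\}_{k\ge0}$ generated by procedure (b) of the general subgradient-based method (Method 1), we have for all $k\ge0$ $$f(\hat x_k)-f(x^* )\le\frac{\beta_kl_d(z_k;x^* )+\frac{1}{2\sigma}\sum_{i=0}^k\frac{\lambda_i^2}{\beta_{i-1}}\|g_i\|_*^2}{S_k}.$$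
   Context: $E$ is a finite-dimensional real vector space with norm $\|\cdot\|$, $E^*$ its dual with dual norm $\|s\|_*=\max_{\|x\|\le1}\langle s,x\rangle$, $\langle s,x\rangle$ the value of $s\in E^*$ at $x\in E$. $Q\subset E$ is a nonempty closed convex (possibly unbounded) set, and $f:E\to\mathbb{R}\cup\{+\infty\}$ is a proper lower semicontinuous convex function with $Q\subset\operatorname{dom} f$; $\partial f(x)=\{g\in E^*: f(y)\ge f(x)+\langle g,y-x\rangle\ \forall y\in E\}$. The problem $\min_{x\in Q}f(x)$ is assumed to have an optimal solution $x^*\in Q$. Prox-function: $d:E\to\mathbb{R}\cup\{+\infty\}$ is a fixed proper lower semicontinuous convex function which is continuously differentiable on $Q$ (in particular finite on $Q$) and strongly convex on $Q$ with parameter $\sigma>0$, i.e. $d(\tau x+(1-\tau)y)\le \tau d(x)+(1-\tau)d(y)-\frac12\sigma\tau(1-\tau)\|x-y\|^2$ for all $x,y\in Q$, $\tau\in[0,1]$. Put $x_0:=\operatorname{argmin}_{x\in Q}d(x)$; it is assumed that $d(x_0)=0$. For $y\in Q$, $l_d(y;x):=d(y)+\langle\nabla d(y),x-y\rangle$. Weight parameters: $\lambda_k>0$ for $k\ge0$; $S_k:=\sum_{i=0}^k\lambda_i$. Scaling parameters: $\beta_k\ge\beta_{k-1}>0$ for $k\ge 0$. Property 1. Auxiliary functions $\psi_k$ ($k\ge-1$), where $\psi_k$ is determined by $\{\lambda_i\}_{i=0}^k,\{\beta_i\}_{i=-1}^k,\{x_i\}_{i=0}^k,\{z_i\}_{i=0}^{k-1}$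 and has a unique minimizer $z_k:=\operatorname{argmin}_{x\in Q}\psi_k(x)$ on $Q$, satisfy Property 1 (for test points $\{x_k\}_{k\ge0}\subset Q$, whose first element is $x_0=\operatorname{argmin}_{x\in Q}d(x)$) if: (i) $\min_{x\in Q}\psi_{-1}(x)=0$ and $z_{-1}=x_0$; (ii) for every $k\ge-1$ and $x\in Q$, $\psi_{k+1}(x)\ge\min_{z\in Q}\psi_k(z)+\lambda_{k+1}l_f(x_{k+1};x)+\beta_{k+1}d(x)-\beta_k l_d(z_k;x)$; (iii) for every $k\ge0$, $\min_{x\in Q}\psi_k(x)\le\inf_{x\in Q}\{\sum_{i=0}^k\lambda_i l_f(x_i;x)+\beta_k l_d(z_k;x)\}$. Standard construction: $\psi_{-1}:=\beta_{-1}d$ and, for each $k\ge-1$, $\psi_{k+1}$ is given by either the extended Mirror-Descent model $\psi_{k+1}(x):=\min_{z\in Q}\psi_k(z)+\lambda_{k+1}l_f(x_{k+1};x)+\beta_{k+1}d(x)-\beta_kl_d(z_k;x)$ or the Dual-Averaging model $\psi_{k+1}(x):=\psi_k(x)+\lambda_{k+1}l_f(x_{k+1};x)+\beta_{k+1}d(x)-\beta_kd(x)$ (free choice for each $k$). Method 1 (general subgradient-based method) generates $\{(z_{k-1},x_k,g_k,\hat x_k)\}_{k\ge0}$, for $k\ge0$, by procedure (a) $x_k:=z_{k-1}:=\operatorname{argmin}_{x\in Q}\psi_{k-1}(x)$, $\ \hat x_k:=\frac1{S_k}\sum_{i=0}^k\lambda_ix_i$, $\ g_k:=g(x_k)\in\partial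 f(x_k)$; or by procedure (b) $z_{k-1}:=\operatorname{argmin}_{x\in Q}\psi_{k-1}(x)$, $\ \hat x_k:=x_k:=\frac1{S_k}\sum_{i=0}^k\lambda_iz_{i-1}$, $\ g_k:=g(x_k)\in\partial f(x_k)$; where $\{\psi_k\}_{k\ge-1}$ is defined by the standard construction, or by any construction satisfying Property 1, with $l_f(y;x)=f(y)+\langle g(y),x-y\rangle$. *)

theory Defs
  imports "HOL-Analysis.Analysis"
begin

text \<open>
  The dual of a finite-dimensional normed space \<open>'a\<close> is the type \<open>'a \<Rightarrow>\<^sub>L real\<close>, on which
  \<open>norm\<close> is the dual norm (see \<open>norm_dual_eq\<close>). Extended-valued functions have type
  \<open>'a \<Rightarrow> ereal\<close>.
\<close>

lemma norm_dual_eq: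
  fixes s :: "'a::real_normed_vector \<Rightarrow>\<^sub>L real"
  shows "norm s = (SUP x\<in>cball 0 1. blinfun_apply s x)"
proof (rule antisym)
  have le: "blinfun_apply s x \<le> norm s" if "x \<in> cball 0 1" for x
    using that norm_blinfun[of s x] mult_left_mono[of "norm x" 1 "norm s"] by auto
  then have bdd: "bdd_above (blinfun_apply s ` cball 0 1)" by (auto intro!: bdd_aboveI2)
  let ?M = "SUP x\<in>cball 0 1. blinfun_apply s x"
  have up: "blinfun_apply s x \<le> ?M" if "norm x \<le> 1" for x
    using that by (intro cSUP_upper[OF _ bdd]) auto
  have "0 \<le> ?M" using up[of 0] by simp
  moreover have "norm (blinfun_apply s x) \<le> ?M * norm x" for x
  proof (cases "x = 0")
    case False
    have "blinfun_apply s (x /\<^sub>R norm x) \<le> ?M" "blinfun_apply s (- (x /\<^sub>R norm x)) \<le> ?M"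
      using False by (intro up; simp)+
    then show ?thesis using False
      by (auto simp: blinfun.scaleR_right blinfun.minus_right field_simps abs_le_iff)
  qed simp
  ultimately show "norm s \<le> ?M" by (rule norm_blinfun_bound)
  show "?M \<le> norm s" by (rule cSUP_least) (auto intro: le)
qed

definition proper :: "('a \<Rightarrow> ereal) \<Rightarrow> bool" where
  "proper h \<longleftrightarrow> (\<forall>x. h x \<noteq> -\<infinity>) \<and> (\<exists>x. h x \<noteq> \<infinity>)"

definition lower_semicontinuous :: "('a::topological_space \<Rightarrow> ereal) \<Rightarrow> bool" where
  "lower_semicontinuous h \<longleftrightarrow> (\<forall>x. h x \<le> Liminf (at x) h)"

definition convex_fun :: "('a::real_vector \<Rightarrow> ereal) \<Rightarrow> bool" where
  "convex_fun h \<longleftrightarrow> (\<forall>x y. \<forall>t\<in>{0..1}.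
     h (t *\<^sub>R x + (1 - t) *\<^sub>R y) \<le> ereal t * h x + ereal (1 - t) * h y)"

definition strongly_convex_on ::
    "'a::real_normed_vector set \<Rightarrow> real \<Rightarrow> ('a \<Rightarrow> ereal) \<Rightarrow> bool" where
  "strongly_convex_on Q \<sigma> h \<longleftrightarrow> (\<forall>x\<in>Q. \<forall>y\<in>Q. \<forall>t\<in>{0..1}.
     h (t *\<^sub>R x + (1 - t) *\<^sub>R y)
       \<le> ereal t * h x + ereal (1 - t) * h y - ereal (\<sigma> / 2 * t * (1 - t) * (norm (x - y))\<^sup>2))"

definition subdifferential ::
    "('a::real_normed_vector \<Rightarrow> ereal) \<Rightarrow> 'a \<Rightarrow> ('a \<Rightarrow>\<^sub>L real) set" where
  "subdifferential h x = {s. \<forall>y. h y \<ge> h x + ereal (blinfun_apply s (y - x))}"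

text \<open>
  \<open>h\<close> is finite and continuously differentiable on \<open>Q\<close>, with gradient \<open>h'\<close>. The derivative is
  taken within \<open>Q\<close>, so that \<open>h\<close> may be infinite arbitrarily close to a boundary point of \<open>Q\<close>.
  If \<open>h\<close> is differentiable in a neighbourhood of \<open>Q\<close>, this is in particular satisfied by the
  ordinary gradient. For convex \<open>Q\<close> the values \<open>h' y (x - y)\<close> with \<open>x, y \<in> Q\<close> do not
  depend on the choice of \<open>h'\<close>.
\<close>

definition continuously_differentiable_on ::
    "'a::real_normed_vector set \<Rightarrow> ('a \<Rightarrow> ereal) \<Rightarrow> ('a \<Rightarrow> 'a \<Rightarrow>\<^sub>L real) \<Rightarrow> bool" where
  "continuously_differentiable_on Q h h' \<longleftrightarrow>
     (\<forall>y\<in>Q. \<bar>h y\<bar> \<noteq> \<infinity>) \<and>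
     (\<forall>y\<in>Q. ((\<lambda>x. real_of_ereal (h x)) has_derivative blinfun_apply (h' y)) (at y within Q)) \<and>
     continuous_on Q h'"

abbreviation argmin_on :: "'a set \<Rightarrow> ('a \<Rightarrow> ereal) \<Rightarrow> 'a \<Rightarrow> bool" where
  "argmin_on Q h x \<equiv> is_arg_min h (\<lambda>y. y \<in> Q) x"

definition prox_function ::
    "'a::real_normed_vector set \<Rightarrow> real \<Rightarrow> ('a \<Rightarrow> ereal) \<Rightarrow> ('a \<Rightarrow> 'a \<Rightarrow>\<^sub>L real) \<Rightarrow> 'a \<Rightarrow> bool" where
  "prox_function Q \<sigma> d d' x0 \<longleftrightarrow>
     proper d \<and> lower_semicontinuous d \<and> convex_fun d \<and>
     continuously_differentiable_on Q d d' \<and>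
     0 < \<sigma> \<and> strongly_convex_on Q \<sigma> d \<and>
     argmin_on Q d x0 \<and> d x0 = 0"

text \<open>
  \<open>lin h h' y x\<close> is \<open>l\<^sub>h(y; x)\<close>: for \<open>l\<^sub>f\<close> the second argument is the subgradient mapping, for
  \<open>l\<^sub>d\<close> it is the gradient.
\<close>

definition lin ::
    "('a::real_normed_vector \<Rightarrow> ereal) \<Rightarrow> ('a \<Rightarrow> 'a \<Rightarrow>\<^sub>L real) \<Rightarrow> 'a \<Rightarrow> 'a \<Rightarrow> ereal" where
  "lin h h' y x = h y + ereal (blinfun_apply (h' y) (x - y))"

text \<open>
  Indexing convention: the sequences \<open>\<beta>\<close>, \<open>\<psi>\<close>, \<open>z\<close>, which mathematically start at index \<open>-1\<close>, are
  shifted by one, i.e. \<open>\<beta> n\<close>, \<open>\<psi> n\<close>, \<open>z n\<close> stand for \<open>\<beta>\<^sub>n\<^sub>-\<^sub>1\<close>, \<open>\<psi>\<^sub>n\<^sub>-\<^sub>1\<close>, \<open>z\<^sub>n\<^sub>-\<^sub>1\<close>.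
  The sequences \<open>\<lambda>\<close>, \<open>x\<close>, \<open>g\<close> and the averages are not shifted. (The weights \<open>\<lambda>\<close> are called \<open>w\<close>.)
\<close>

definition weight_sum :: "(nat \<Rightarrow> real) \<Rightarrow> nat \<Rightarrow> real" where
  "weight_sum w k = (\<Sum>i\<le>k. w i)"

text \<open>
  The right-hand side of the extended Mirror-Descent model for \<open>\<psi>\<^sub>n\<close> in terms of \<open>\<psi>\<^sub>n\<^sub>-\<^sub>1\<close>
  (i.e. with \<open>k = n - 1\<close>); it is also the lower bound in
  \<open>auxiliary_property\<close>.
\<close>

definition md_model ::
    "'a::real_normed_vector set \<Rightarrow> ('a \<Rightarrow> ereal) \<Rightarrow> ('a \<Rightarrow> 'a \<Rightarrow>\<^sub>L real) \<Rightarrow>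
     ('a \<Rightarrow> ereal) \<Rightarrow> ('a \<Rightarrow> 'a \<Rightarrow>\<^sub>L real) \<Rightarrow> (nat \<Rightarrow> real) \<Rightarrow> (nat \<Rightarrow> real) \<Rightarrow>
     (nat \<Rightarrow> 'a \<Rightarrow> ereal) \<Rightarrow> (nat \<Rightarrow> 'a) \<Rightarrow> (nat \<Rightarrow> 'a) \<Rightarrow> nat \<Rightarrow> 'a \<Rightarrow> ereal" where
  "md_model Q f g d d' w \<beta> \<psi> z x n y =
     (INF u\<in>Q. \<psi> n u) + ereal (w n) * lin f g (x n) y
       + ereal (\<beta> (Suc n)) * d y - ereal (\<beta> n) * lin d d' (z n) y"

definition da_model ::
    "('a::real_normed_vector \<Rightarrow> ereal) \<Rightarrow> ('a \<Rightarrow> 'a \<Rightarrow>\<^sub>L real) \<Rightarrow> ('a \<Rightarrow> ereal) \<Rightarrow>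
     (nat \<Rightarrow> real) \<Rightarrow> (nat \<Rightarrow> real) \<Rightarrow>
     (nat \<Rightarrow> 'a \<Rightarrow> ereal) \<Rightarrow> (nat \<Rightarrow> 'a) \<Rightarrow> nat \<Rightarrow> 'a \<Rightarrow> ereal" where
  "da_model f g d w \<beta> \<psi> x n y =
     \<psi> n y + ereal (w n) * lin f g (x n) y + ereal (\<beta> (Suc n)) * d y - ereal (\<beta> n) * d y"

text \<open>
  Only the values on \<open>Q\<close> are prescribed: off the domain of \<open>d\<close> the formulas contain
  \<open>\<infinity> - \<infinity>\<close>, and the auxiliary functions are only ever minimized over \<open>Q\<close>.
\<close>

definition standard_construction ::
    "'a::real_normed_vector set \<Rightarrow> ('a \<Rightarrow> ereal) \<Rightarrow> ('a \<Rightarrow> 'a \<Rightarrow>\<^sub>L real) \<Rightarrow>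
     ('a \<Rightarrow> ereal) \<Rightarrow> ('a \<Rightarrow> 'a \<Rightarrow>\<^sub>L real) \<Rightarrow> (nat \<Rightarrow> real) \<Rightarrow> (nat \<Rightarrow> real) \<Rightarrow>
     (nat \<Rightarrow> 'a \<Rightarrow> ereal) \<Rightarrow> (nat \<Rightarrow> 'a) \<Rightarrow> (nat \<Rightarrow> 'a) \<Rightarrow> bool" where
  "standard_construction Q f g d d' w \<beta> \<psi> z x \<longleftrightarrow>
     (\<forall>y\<in>Q. \<psi> 0 y = ereal (\<beta> 0) * d y) \<and>
     (\<forall>n. (\<forall>y\<in>Q. \<psi> (Suc n) y = md_model Q f g d d' w \<beta> \<psi> z x n y) \<or>
          (\<forall>y\<in>Q. \<psi> (Suc n) y = da_model f g d w \<beta> \<psi> x n y))"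

text \<open>
  That \<open>\<psi>\<^sub>k\<close> may depend on the parameters and points generated so far is reflected by stating the
  property for the sequences of a single run rather than for fixed functions \<open>\<psi>\<^sub>k\<close>.
\<close>

definition auxiliary_property ::
    "'a::real_normed_vector set \<Rightarrow> ('a \<Rightarrow> ereal) \<Rightarrow> ('a \<Rightarrow> 'a \<Rightarrow>\<^sub>L real) \<Rightarrow>
     ('a \<Rightarrow> ereal) \<Rightarrow> ('a \<Rightarrow> 'a \<Rightarrow>\<^sub>L real) \<Rightarrow> 'a \<Rightarrow> (nat \<Rightarrow> real) \<Rightarrow> (nat \<Rightarrow> real) \<Rightarrow>
     (nat \<Rightarrow> 'a \<Rightarrow> ereal) \<Rightarrow> (nat \<Rightarrow> 'a) \<Rightarrow> (nat \<Rightarrow> 'a) \<Rightarrow> bool" where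
  "auxiliary_property Q f g d d' x0 w \<beta> \<psi> z x \<longleftrightarrow>
     (\<forall>n. argmin_on Q (\<psi> n) (z n) \<and> (\<forall>u. argmin_on Q (\<psi> n) u \<longrightarrow> u = z n)) \<and>
     (\<forall>k. x k \<in> Q) \<and>
     x 0 = x0 \<and>
     (INF u\<in>Q. \<psi> 0 u) = 0 \<and> z 0 = x0 \<and>
     (\<forall>n. \<forall>y\<in>Q. \<psi> (Suc n) y \<ge> md_model Q f g d d' w \<beta> \<psi> z x n y) \<and>
     (\<forall>k. (INF u\<in>Q. \<psi> (Suc k) u)
           \<le> (INF y\<in>Q. (\<Sum>i\<le>k. ereal (w i) * lin f g (x i) y)
                        + ereal (\<beta> (Suc k)) * lin d d' (z (Suc k)) y))"

definition procedure_a ::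
    "'a::real_normed_vector set \<Rightarrow> ('a \<Rightarrow> 'a \<Rightarrow>\<^sub>L real) \<Rightarrow> (nat \<Rightarrow> real) \<Rightarrow>
     (nat \<Rightarrow> 'a \<Rightarrow> ereal) \<Rightarrow> (nat \<Rightarrow> 'a) \<Rightarrow> (nat \<Rightarrow> 'a) \<Rightarrow> (nat \<Rightarrow> 'a \<Rightarrow>\<^sub>L real) \<Rightarrow> (nat \<Rightarrow> 'a) \<Rightarrow> bool"
  where
  "procedure_a Q g w \<psi> z x gs xhat \<longleftrightarrow>
     (\<forall>k. argmin_on Q (\<psi> k) (z k) \<and> x k = z k \<and>
          xhat k = (1 / weight_sum w k) *\<^sub>R (\<Sum>i\<le>k. w i *\<^sub>R x i) \<and>
          gs k = g (x k))"

definition procedure_b ::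
    "'a::real_normed_vector set \<Rightarrow> ('a \<Rightarrow> 'a \<Rightarrow>\<^sub>L real) \<Rightarrow> (nat \<Rightarrow> real) \<Rightarrow>
     (nat \<Rightarrow> 'a \<Rightarrow> ereal) \<Rightarrow> (nat \<Rightarrow> 'a) \<Rightarrow> (nat \<Rightarrow> 'a) \<Rightarrow> (nat \<Rightarrow> 'a \<Rightarrow>\<^sub>L real) \<Rightarrow> (nat \<Rightarrow> 'a) \<Rightarrow> bool"
  where
  "procedure_b Q g w \<psi> z x gs xhat \<longleftrightarrow>
     (\<forall>k. argmin_on Q (\<psi> k) (z k) \<and>
          x k = (1 / weight_sum w k) *\<^sub>R (\<Sum>i\<le>k. w i *\<^sub>R z i) \<and> xhat k = x k \<and>
          gs k = g (x k))"

end

theory Submission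
  imports Defs
begin

text \<open>
  The minima of the auxiliary functions sandwich the quantity to be estimated.  From above, the
  last condition of the auxiliary property, evaluated at \<open>xstar\<close>, together with the subgradient inequality
  \<open>l\<^sub>f(x\<^sub>i; xstar) \<le> f(xstar)\<close>, bounds the minimum of \<open>\<psi>\<^sub>k\<close> by
  \<open>S\<^sub>k f(xstar) + \<beta>\<^sub>k l\<^sub>d(z\<^sub>k; xstar)\<close>.  From below, the condition that
  \<open>\<psi>\<close> dominates the mirror-descent model gives a recursion: since \<open>d \<ge> 0\<close> on
  \<open>Q\<close> and \<open>\<beta>\<close> is nondecreasing, the prox-terms contribute at least \<open>\<beta>\<close> times the Bregman distance
  of \<open>d\<close>, hence by strong convexity a quadratic in \<open>norm (y - z)\<close>.  This quadratic absorbs the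
  slope \<open>\<lambda> \<langle>g, y - z\<rangle>\<close> of the new linearization at the cost of
  \<open>\<lambda>\<^sup>2 (norm g)\<^sup>2 / (2 \<sigma> \<beta>)\<close>, which is where the sum in the rate comes from
  (\<open>estimate_sequence_le_INF\<close>, \<open>estimate_sequence_rate\<close>).

  The two procedures are two ways to centre that linearization at \<open>z\<close>.  In procedure (a) the test
  point is \<open>z\<close> itself, and the accumulated lower bound is \<open>\<Sum> \<lambda>\<^sub>i f(x\<^sub>i)\<close>; Jensen's inequality then
  passes to the average.  In procedure (b) the test point is an average of the previous test point
  and \<open>z\<close>, so that the linearization of \<open>S\<^sub>k f(x\<^sub>k)\<close> at the new test point supplies exactly the
  missing shift, and the accumulated lower bound is \<open>S\<^sub>k f(x\<^sub>k)\<close>.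

  The standard construction is reduced to the auxiliary property
  (\<open>standard_construction_auxiliary_property\<close>).  On \<open>Q\<close> each of its functions is affine plus a
  multiple of \<open>d\<close>, so that first-order optimality at \<open>z\<close> gives
  \<open>\<psi>(y) \<ge> \<psi>(z) + \<beta> (d(y) - l\<^sub>d(z; y))\<close>; this growth estimate yields the uniqueness of the
  minimizer and the comparison with the mirror-descent model, and, together with
  \<open>\<psi>\<^sub>k \<le> \<Sum> \<lambda>\<^sub>i l\<^sub>f(x\<^sub>i; _) + \<beta>\<^sub>k d\<close>, the upper bound on the minimum.
\<close>

section \<open>Convexity and one-sided derivatives\<close>

lemma has_derivative_within_convex_ray:
  fixes h :: "'a::real_normed_vector \<Rightarrow> real"
  assumes "convex Q" "z \<in> Q" "y \<in> Q"
    and "(h has_derivative h') (at z within Q)"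
  shows "((\<lambda>t. (h (z + t *\<^sub>R (y - z)) - h z) / t) \<longlongrightarrow> h' (y - z)) (at_right 0)"
proof -
  let ?r = "\<lambda>t::real. z + t *\<^sub>R (y - z)"
  have ray: "?r ` {0..1} \<subseteq> Q"
    using convexD_alt[OF assms(1,2,3)] by (auto simp: algebra_simps)
  have "(?r has_derivative (\<lambda>t. t *\<^sub>R (y - z))) (at 0 within {0..1})"
    by (auto intro!: derivative_eq_intros)
  moreover have "(h has_derivative h') (at (?r 0) within ?r ` {0..1})"
    using has_derivative_subset[OF assms(4) ray] by simp
  ultimately have "((h \<circ> ?r) has_derivative (h' \<circ> (\<lambda>t. t *\<^sub>R (y - z)))) (at 0 within {0..1})"
    by (rule diff_chain_within)
  moreover have "h' (t *\<^sub>R (y - z)) = h' (y - z) * t" for t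
    using linear_scale[OF has_derivative_linear[OF assms(4)]] by simp
  ultimately have "((h \<circ> ?r) has_real_derivative h' (y - z)) (at 0 within {0..1})"
    by (simp add: has_field_derivative_def o_def mult.commute[of _ "h' (y - z)"])
  then show ?thesis
    by (simp add: has_field_derivative_iff at_within_Icc_at_right)
qed

text \<open>
  Bound the pairing by \<open>- norm s * norm v\<close> and complete the square in \<open>norm v\<close>.  With
  \<open>c = \<beta> n * \<sigma>\<close>, the loss on the right is the price of one subgradient step in the final rate.
\<close>

lemma dual_pairing_plus_quadratic_ge:
  fixes s :: "'a::real_normed_vector \<Rightarrow>\<^sub>L real"
  assumes "0 < c" "0 \<le> w"
  shows "w * s v + c / 2 * (norm v)\<^sup>2 \<ge> - (w\<^sup>2 * (norm s)\<^sup>2 / (2 * c))"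
proof -
  have "- (norm s * norm v) \<le> s v"
    using norm_blinfun[of s v] by (simp add: abs_le_iff)
  then have "w * s v \<ge> - (w * norm s * norm v)"
    using mult_left_mono[of "- (norm s * norm v)" "s v" w] assms(2) by (simp add: mult.assoc)
  moreover have "0 \<le> (w * norm s - c * norm v)\<^sup>2 / (2 * c)"
    using assms(1) by simp
  then have "0 \<le> w\<^sup>2 * (norm s)\<^sup>2 / (2 * c) - w * norm s * norm v + c / 2 * (norm v)\<^sup>2"
    using assms(1) by (simp add: power2_eq_square field_simps)
  ultimately show ?thesis by linarith
qed

lemma INF_eq_argmin_on:
  fixes h :: "'a \<Rightarrow> ereal"
  assumes "argmin_on Q h z"
  shows "(INF u\<in>Q. h u) = h z"
  using assms by (intro antisym INF_lower INF_greatest) (auto simp: is_arg_min_linorder)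

section \<open>Prox-functions\<close>

locale prox_setting =
  fixes Q :: "'a::real_normed_vector set" and \<sigma> :: real
    and d :: "'a \<Rightarrow> ereal" and d' :: "'a \<Rightarrow> 'a \<Rightarrow>\<^sub>L real" and x0 :: 'a
  assumes convex_Q: "convex Q"
    and prox: "prox_function Q \<sigma> d d' x0"
begin

definition D :: "'a \<Rightarrow> real" where "D y = real_of_ereal (d y)"

definition bregman :: "'a \<Rightarrow> 'a \<Rightarrow> real" where
  "bregman z y = D y - (D z + d' z (y - z))"

lemma d_eq: "y \<in> Q \<Longrightarrow> d y = ereal (D y)"
  using prox by (simp add: prox_function_def continuously_differentiable_on_def D_def ereal_real)

lemma sigma_pos: "0 < \<sigma>" and x0_in: "x0 \<in> Q" and d_x0: "D x0 = 0"
  using prox by (auto simp: prox_function_def is_arg_min_def D_def)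

lemma D_nonneg: "y \<in> Q \<Longrightarrow> 0 \<le> D y"
  using prox d_eq[of y] by (auto simp: prox_function_def is_arg_min_linorder)

lemma lin_d_eq: "z \<in> Q \<Longrightarrow> lin d d' z y = ereal (D z + d' z (y - z))"
  by (simp add: lin_def d_eq)

lemma D_derivative: "z \<in> Q \<Longrightarrow> (D has_derivative d' z) (at z within Q)"
  using prox by (simp add: prox_function_def continuously_differentiable_on_def D_def[abs_def])

lemma D_strongly_convex:
  assumes "y \<in> Q" "z \<in> Q" "0 \<le> t" "t \<le> 1"
  shows "D (z + t *\<^sub>R (y - z)) \<le> D z + t * (D y - D z) - \<sigma> / 2 * t * (1 - t) * (norm (y - z))\<^sup>2"
proof -
  have eq: "t *\<^sub>R y + (1 - t) *\<^sub>R z = z + t *\<^sub>R (y - z)"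
    by (simp add: algebra_simps)
  have "z + t *\<^sub>R (y - z) \<in> Q"
    using convexD[OF convex_Q assms(1,2,3), of "1 - t"] assms(4) eq by simp
  moreover have "d (t *\<^sub>R y + (1 - t) *\<^sub>R z) \<le> ereal t * d y + ereal (1 - t) * d z
       - ereal (\<sigma> / 2 * t * (1 - t) * (norm (y - z))\<^sup>2)"
    using prox assms by (auto simp: prox_function_def strongly_convex_on_def)
  ultimately show ?thesis
    using assms by (simp add: eq d_eq algebra_simps)
qed

text \<open>
  Dividing the strong convexity inequality along the segment from \<open>z\<close> to \<open>y\<close> by the step \<open>t\<close>
  and letting \<open>t\<close> tend to zero turns the difference quotient into the derivative of \<open>d\<close>.
\<close>

lemma bregman_ge_quadratic:
  assumes "y \<in> Q" "z \<in> Q"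
  shows "\<sigma> / 2 * (norm (y - z))\<^sup>2 \<le> bregman z y"
proof -
  let ?q = "\<lambda>t. (D (z + t *\<^sub>R (y - z)) - D z) / t"
  let ?b = "\<lambda>t. D y - D z - \<sigma> / 2 * (1 - t) * (norm (y - z))\<^sup>2"
  have "(?q \<longlongrightarrow> d' z (y - z)) (at_right 0)"
    using has_derivative_within_convex_ray[OF convex_Q assms(2,1) D_derivative[OF assms(2)]] .
  moreover have "(?b \<longlongrightarrow> D y - D z - \<sigma> / 2 * (1 - 0) * (norm (y - z))\<^sup>2) (at_right 0)"
    by (intro tendsto_intros)
  moreover have "eventually (\<lambda>t. ?q t \<le> ?b t) (at_right 0)"
  proof -
    have "?q t \<le> ?b t" if "0 < t" "t < 1" for t
    proof -
      have "D (z + t *\<^sub>R (y - z)) - D z \<le> ?b t * t"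
        using D_strongly_convex[OF assms, of t] that by (simp add: algebra_simps)
      then show ?thesis using that(1) by (simp add: pos_divide_le_eq)
    qed
    then show ?thesis
      by (auto simp: eventually_at_right_field intro!: exI[of _ 1])
  qed
  ultimately have "d' z (y - z) \<le> D y - D z - \<sigma> / 2 * (1 - 0) * (norm (y - z))\<^sup>2"
    using tendsto_le[OF trivial_limit_at_right_real] by blast
  then show ?thesis by (simp add: bregman_def)
qed

text \<open>
  An affine function does not change Bregman distances, so the first-order optimality condition
  at \<open>z\<close> says that the whole gap to the minimum is at least the Bregman distance of \<open>b d\<close>.
\<close>

lemma affine_plus_prox_argmin_gap:
  fixes a :: "'a \<Rightarrow>\<^sub>L real"
  assumes z: "z \<in> Q" "\<And>y. y \<in> Q \<Longrightarrow> c + a z + b * D z \<le> c + a y + b * D y"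
    and y: "y \<in> Q"
  shows "c + a z + b * D z + b * bregman z y \<le> c + a y + b * D y"
proof -
  let ?h = "\<lambda>y. c + a y + b * D y"
  have "(?h has_derivative (\<lambda>v. a v + b * d' z v)) (at z within Q)"
    using D_derivative[OF z(1)]
    by (auto intro!: derivative_eq_intros bounded_linear_imp_has_derivative blinfun.bounded_linear_right)
  then have "((\<lambda>t. (?h (z + t *\<^sub>R (y - z)) - ?h z) / t) \<longlongrightarrow> a (y - z) + b * d' z (y - z)) (at_right 0)"
    by (rule has_derivative_within_convex_ray[OF convex_Q z(1) y])
  moreover have "eventually (\<lambda>t. 0 \<le> (?h (z + t *\<^sub>R (y - z)) - ?h z) / t) (at_right 0)"
  proof -
    have "0 \<le> (?h (z + t *\<^sub>R (y - z)) - ?h z) / t" if "0 < t" "t < 1" for t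
      using z(2)[of "z + t *\<^sub>R (y - z)"] convexD_alt[OF convex_Q z(1) y, of t] that
      by (simp add: algebra_simps)
    then show ?thesis
      by (auto simp: eventually_at_right_field intro!: exI[of _ 1])
  qed
  ultimately have "0 \<le> a (y - z) + b * d' z (y - z)"
    by (rule tendsto_lowerbound) simp
  then show ?thesis
    by (simp add: bregman_def blinfun.diff_right algebra_simps)
qed

end

section \<open>The standard construction has the auxiliary property\<close>

locale subgradient_setting = prox_setting +
  fixes f :: "'a::real_normed_vector \<Rightarrow> ereal" and g :: "'a \<Rightarrow> 'a \<Rightarrow>\<^sub>L real"
    and w \<beta> :: "nat \<Rightarrow> real"
  assumes f_proper: "proper f" and f_finite: "\<forall>y\<in>Q. f y < \<infinity>"
    and g_subgradient: "\<forall>y\<in>Q. g y \<in> subdifferential f y"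
    and w_pos: "\<forall>k. 0 < w k"
    and \<beta>_pos_mono: "\<forall>n. 0 < \<beta> n \<and> \<beta> n \<le> \<beta> (Suc n)"
begin

definition F :: "'a \<Rightarrow> real" where "F y = real_of_ereal (f y)"

definition lF :: "'a \<Rightarrow> 'a \<Rightarrow> real" where "lF x y = F x + g x (y - x)"

lemma f_eq: "y \<in> Q \<Longrightarrow> f y = ereal (F y)"
  using f_proper f_finite by (cases "f y") (auto simp: proper_def F_def)

lemma lin_f_eq: "x \<in> Q \<Longrightarrow> lin f g x y = ereal (lF x y)"
  by (simp add: lin_def f_eq lF_def)

lemma lF_le: "x \<in> Q \<Longrightarrow> y \<in> Q \<Longrightarrow> lF x y \<le> F y"
proof -
  assume *: "x \<in> Q" "y \<in> Q"
  then have "f x + ereal (g x (y - x)) \<le> f y"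
    using g_subgradient by (auto simp: subdifferential_def)
  then show ?thesis using * by (simp add: f_eq lF_def)
qed

lemma \<beta>_pos: "0 < \<beta> n" and \<beta>_mono: "\<beta> n \<le> \<beta> (Suc n)"
  using \<beta>_pos_mono by auto

lemma weight_sum_pos: "0 < weight_sum w k"
  unfolding weight_sum_def using w_pos by (intro sum_pos) auto

lemma md_model_eq:
  assumes "y \<in> Q" "z n \<in> Q" "x n \<in> Q"
  shows "md_model Q f g d d' w \<beta> \<psi> z x n y =
    (INF u\<in>Q. \<psi> n u) + ereal (w n * lF (x n) y + \<beta> (Suc n) * D y - \<beta> n * (D (z n) + d' (z n) (y - z n)))"
  using assms
  by (cases "INF u\<in>Q. \<psi> n u") (simp_all add: md_model_def lin_f_eq lin_d_eq d_eq)

lemma da_model_eq: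
  assumes "y \<in> Q" "x n \<in> Q"
  shows "da_model f g d w \<beta> \<psi> x n y =
    \<psi> n y + ereal (w n * lF (x n) y + \<beta> (Suc n) * D y - \<beta> n * D y)"
  using assms by (cases "\<psi> n y") (simp_all add: da_model_def lin_f_eq d_eq)

text \<open>
  Both models add affine functions to a multiple of \<open>d\<close>, and the coefficient of \<open>d\<close> is \<open>\<beta>\<close>:
  the mirror-descent model starts afresh from a constant, whereas the dual-averaging model
  replaces \<open>\<beta> n\<close> by \<open>\<beta> (Suc n)\<close>.
\<close>

lemma standard_construction_affine_plus_prox:
  assumes std: "standard_construction Q f g d d' w \<beta> \<psi> z x"
    and z: "\<And>n. argmin_on Q (\<psi> n) (z n)" and x: "\<And>n. x n \<in> Q"
  shows "\<exists>c (a::'a \<Rightarrow>\<^sub>L real). \<forall>y\<in>Q. \<psi> n y = ereal (c + a y + \<beta> n * D y)"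
proof (induction n)
  case 0
  have "\<forall>y\<in>Q. \<psi> 0 y = ereal (0 + (0::'a \<Rightarrow>\<^sub>L real) y + \<beta> 0 * D y)"
    using std by (simp add: standard_construction_def d_eq)
  then show ?case by blast
next
  case (Suc n)
  then obtain c and a :: "'a \<Rightarrow>\<^sub>L real" where
    n: "\<forall>y\<in>Q. \<psi> n y = ereal (c + a y + \<beta> n * D y)" by blast
  have zQ: "z n \<in> Q" using z by (simp add: is_arg_min_def)
  define m where "m = c + a (z n) + \<beta> n * D (z n)"
  have m: "(INF u\<in>Q. \<psi> n u) = ereal m"
    using INF_eq_argmin_on[OF z, of n] bspec[OF n zQ] by (simp only: m_def)
  from std consider
      (md) "\<forall>y\<in>Q. \<psi> (Suc n) y = md_model Q f g d d' w \<beta> \<psi> z x n y"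
    | (da) "\<forall>y\<in>Q. \<psi> (Suc n) y = da_model f g d w \<beta> \<psi> x n y"
    unfolding standard_construction_def by blast
  then show ?case
  proof cases
    case md
    let ?c = "m + w n * (F (x n) - g (x n) (x n)) - \<beta> n * (D (z n) - d' (z n) (z n))"
    let ?a = "w n *\<^sub>R g (x n) - \<beta> n *\<^sub>R d' (z n)"
    have "\<forall>y\<in>Q. \<psi> (Suc n) y = ereal (?c + ?a y + \<beta> (Suc n) * D y)"
      using md zQ x by (simp add: md_model_eq m lF_def blinfun.diff_right blinfun.diff_left
          blinfun.scaleR_left algebra_simps)
    then show ?thesis by blast
  next
    case da
    let ?c = "c + w n * (F (x n) - g (x n) (x n))"
    let ?a = "a + w n *\<^sub>R g (x n)"
    have "\<forall>y\<in>Q. \<psi> (Suc n) y = ereal (?c + ?a y + \<beta> (Suc n) * D y)"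
      using da n x by (simp add: da_model_eq lF_def blinfun.diff_right blinfun.add_left
          blinfun.scaleR_left algebra_simps)
    then show ?thesis by blast
  qed
qed

text \<open>
  The growth estimate behind the whole verification: it makes the minimizer unique, it shows that
  the dual-averaging model dominates the mirror-descent model, and it trades \<open>d\<close> for \<open>l\<^sub>d\<close> in
  the upper bound.
\<close>

lemma standard_construction_gap:
  assumes std: "standard_construction Q f g d d' w \<beta> \<psi> z x"
    and z: "\<And>n. argmin_on Q (\<psi> n) (z n)" and x: "\<And>n. x n \<in> Q"
    and y: "y \<in> Q"
  shows "\<psi> n (z n) + ereal (\<beta> n * bregman (z n) y) \<le> \<psi> n y"
proof -
  obtain c and a :: "'a \<Rightarrow>\<^sub>L real" where
    n: "\<forall>y\<in>Q. \<psi> n y = ereal (c + a y + \<beta> n * D y)"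
    using standard_construction_affine_plus_prox[OF std z x] by blast
  have zQ: "z n \<in> Q" and min: "\<And>y. y \<in> Q \<Longrightarrow> \<psi> n (z n) \<le> \<psi> n y"
    using z[of n] by (auto simp: is_arg_min_linorder)
  have "c + a (z n) + \<beta> n * D (z n) \<le> c + a y + \<beta> n * D y" if "y \<in> Q" for y
    using min[OF that] n zQ that by simp
  from affine_plus_prox_argmin_gap[OF zQ this y] show ?thesis
    using n zQ y by simp
qed

lemma standard_construction_argmin_unique:
  assumes std: "standard_construction Q f g d d' w \<beta> \<psi> z x"
    and z: "\<And>n. argmin_on Q (\<psi> n) (z n)" and x: "\<And>n. x n \<in> Q"
    and u: "argmin_on Q (\<psi> n) u"
  shows "u = z n"
proof -
  have uQ: "u \<in> Q" and zQ: "z n \<in> Q" and le: "\<psi> n u \<le> \<psi> n (z n)"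
    using u z[of n] by (auto simp: is_arg_min_linorder)
  obtain m where m: "\<psi> n (z n) = ereal m"
    using standard_construction_affine_plus_prox[OF std z x, of n] zQ by blast
  have "\<psi> n (z n) + ereal (\<beta> n * bregman (z n) u) \<le> \<psi> n (z n)"
    using standard_construction_gap[OF std z x uQ, of n] le by (rule order_trans)
  then have "\<beta> n * bregman (z n) u \<le> 0" using m by simp
  then have "bregman (z n) u \<le> 0" using \<beta>_pos[of n] by (simp add: mult_le_0_iff)
  then have "\<sigma> * (norm (u - z n))\<^sup>2 \<le> 0" using bregman_ge_quadratic[OF uQ zQ] by linarith
  then show ?thesis using sigma_pos by (simp add: mult_le_0_iff)
qed

text \<open>
  The bound is stable under both models: dual averaging adds the same increment to both sides,
  and mirror descent first replaces \<open>\<psi> n\<close> by its minimum plus \<open>\<beta> n\<close> times the Bregman distance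
  from \<open>z n\<close>, which is no larger by the growth estimate.
\<close>

lemma standard_construction_upper:
  assumes std: "standard_construction Q f g d d' w \<beta> \<psi> z x"
    and z: "\<And>n. argmin_on Q (\<psi> n) (z n)" and x: "\<And>n. x n \<in> Q"
    and y: "y \<in> Q"
  shows "\<psi> n y \<le> ereal ((\<Sum>i<n. w i * lF (x i) y) + \<beta> n * D y)"
proof (induction n)
  case 0
  then show ?case using std y by (simp add: standard_construction_def d_eq)
next
  case (Suc n)
  have zQ: "z n \<in> Q" using z by (simp add: is_arg_min_def)
  obtain m p where mp: "\<psi> n (z n) = ereal m" "\<psi> n y = ereal p"
    using standard_construction_affine_plus_prox[OF std z x, of n] zQ y by blast
  note gap = standard_construction_gap[OF std z x y, of n, unfolded mp]
  from std consider
      (md) "\<forall>y\<in>Q. \<psi> (Suc n) y = md_model Q f g d d' w \<beta> \<psi> z x n y"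
    | (da) "\<forall>y\<in>Q. \<psi> (Suc n) y = da_model f g d w \<beta> \<psi> x n y"
    unfolding standard_construction_def by blast
  then show ?case
  proof cases
    case md
    then show ?thesis using gap Suc.IH zQ x y
      by (simp add: md_model_eq INF_eq_argmin_on[OF z] mp bregman_def algebra_simps)
  next
    case da
    then show ?thesis using Suc.IH x y
      by (simp add: da_model_eq mp algebra_simps)
  qed
qed

lemma standard_construction_auxiliary_property:
  assumes std: "standard_construction Q f g d d' w \<beta> \<psi> z x"
    and z: "\<And>n. argmin_on Q (\<psi> n) (z n)" and x: "\<And>n. x n \<in> Q"
    and x_0: "x 0 = z 0"
  shows "auxiliary_property Q f g d d' x0 w \<beta> \<psi> z x"
proof -
  have zQ: "z n \<in> Q" for n using z by (simp add: is_arg_min_def)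
  have fin: "\<exists>r. \<psi> n y = ereal r" if "y \<in> Q" for n y
    using standard_construction_affine_plus_prox[OF std z x, of n] that by blast
  have psi0: "\<psi> 0 y = ereal (\<beta> 0 * D y)" if "y \<in> Q" for y
    using std that by (simp add: standard_construction_def d_eq)
  have "argmin_on Q (\<psi> 0) x0"
    using D_nonneg \<beta>_pos[of 0] by (auto simp: is_arg_min_linorder psi0 x0_in d_x0)
  then have z_0: "z 0 = x0" and inf_0: "(INF u\<in>Q. \<psi> 0 u) = 0"
    using standard_construction_argmin_unique[OF std z x] INF_eq_argmin_on[where Q = Q and h = "\<psi> 0" and z = x0]
    by (auto simp: psi0 x0_in d_x0)
  have lower: "md_model Q f g d d' w \<beta> \<psi> z x n y \<le> \<psi> (Suc n) y" if y: "y \<in> Q" for n y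
  proof -
    obtain m p where mp: "\<psi> n (z n) = ereal m" "\<psi> n y = ereal p"
      using fin zQ y by metis
    have "da_model f g d w \<beta> \<psi> x n y \<ge> md_model Q f g d d' w \<beta> \<psi> z x n y"
      using standard_construction_gap[OF std z x y, of n] zQ x y
      by (simp add: da_model_eq md_model_eq INF_eq_argmin_on[OF z] mp bregman_def algebra_simps)
    then show ?thesis using std y unfolding standard_construction_def by (metis order_refl)
  qed
  have upper: "(INF u\<in>Q. \<psi> (Suc k) u)
      \<le> (INF y\<in>Q. (\<Sum>i\<le>k. ereal (w i) * lin f g (x i) y) + ereal (\<beta> (Suc k)) * lin d d' (z (Suc k)) y)"
    for k
  proof (rule INF_greatest)
    fix y assume y: "y \<in> Q"
    obtain m p where mp: "\<psi> (Suc k) (z (Suc k)) = ereal m" "\<psi> (Suc k) y = ereal p"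
      using fin zQ y by metis
    have "m + \<beta> (Suc k) * bregman (z (Suc k)) y \<le> (\<Sum>i\<le>k. w i * lF (x i) y) + \<beta> (Suc k) * D y"
      using standard_construction_gap[OF std z x y, of "Suc k"]
        standard_construction_upper[OF std z x y, of "Suc k"]
      by (simp add: mp lessThan_Suc_atMost)
    then show "(INF u\<in>Q. \<psi> (Suc k) u)
      \<le> (\<Sum>i\<le>k. ereal (w i) * lin f g (x i) y) + ereal (\<beta> (Suc k)) * lin d d' (z (Suc k)) y"
      by (simp add: INF_eq_argmin_on[OF z] mp lin_f_eq[OF x] lin_d_eq[OF zQ] bregman_def algebra_simps)
  qed
  show ?thesis
    unfolding auxiliary_property_def
    using z x x_0 z_0 inf_0 lower upper standard_construction_argmin_unique[OF std z x] by auto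
qed

section \<open>Estimate sequences\<close>

text \<open>
  Lower bounds for the minima of the auxiliary functions.  The hypothesis on \<open>\<phi>\<close> isolates what
  distinguishes the two procedures: at each step the new linearization has to be centred at
  \<open>z n\<close>, so that its slope can be absorbed by the quadratic \<open>\<beta> n * \<sigma> / 2 * (norm (y - z n))\<^sup>2\<close>
  that the prox-terms supply.
\<close>

lemma estimate_sequence_le_INF:
  assumes aux: "auxiliary_property Q f g d d' x0 w \<beta> \<psi> z x"
    and \<phi>_0: "\<phi> 0 = 0"
    and \<phi>_Suc: "\<And>n y. y \<in> Q \<Longrightarrow>
      \<phi> (Suc n) + w n * g (x n) (y - z n) \<le> \<phi> n + w n * lF (x n) y"
  shows "ereal (\<phi> n - 1 / (2 * \<sigma>) * (\<Sum>i<n. (w i)\<^sup>2 / \<beta> i * (norm (g (x i)))\<^sup>2)) \<le> (INF u\<in>Q. \<psi> n u)"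
proof (induction n)
  case 0
  then show ?case using aux \<phi>_0 by (simp add: auxiliary_property_def)
next
  case (Suc n)
  let ?E = "\<lambda>n. 1 / (2 * \<sigma>) * (\<Sum>i<n. (w i)\<^sup>2 / \<beta> i * (norm (g (x i)))\<^sup>2)"
  show ?case
  proof (rule INF_greatest)
    fix y assume y: "y \<in> Q"
    have zQ: "z n \<in> Q" and xQ: "x n \<in> Q"
      using aux by (auto simp: auxiliary_property_def is_arg_min_def)
    have "\<beta> n * D y \<le> \<beta> (Suc n) * D y"
      using \<beta>_mono D_nonneg[OF y] by (rule mult_right_mono)
    moreover have "\<beta> n * (\<sigma> / 2 * (norm (y - z n))\<^sup>2) \<le> \<beta> n * bregman (z n) y"
      using bregman_ge_quadratic[OF y zQ] \<beta>_pos[of n] by simp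
    moreover have "- ((w n)\<^sup>2 * (norm (g (x n)))\<^sup>2 / (2 * (\<beta> n * \<sigma>)))
        \<le> w n * g (x n) (y - z n) + \<beta> n * \<sigma> / 2 * (norm (y - z n))\<^sup>2"
      using w_pos \<beta>_pos sigma_pos by (intro dual_pairing_plus_quadratic_ge) (auto intro: less_imp_le)
    moreover have "?E (Suc n) = ?E n + (w n)\<^sup>2 * (norm (g (x n)))\<^sup>2 / (2 * (\<beta> n * \<sigma>))"
      by (simp add: algebra_simps add_divide_distrib)
    ultimately have "\<phi> (Suc n) - ?E (Suc n) \<le> \<phi> n - ?E n +
        (w n * lF (x n) y + \<beta> (Suc n) * D y - \<beta> n * (D (z n) + d' (z n) (y - z n)))"
      using \<phi>_Suc[OF y, of n] by (simp add: bregman_def algebra_simps)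
    then have "ereal (\<phi> (Suc n) - ?E (Suc n)) \<le> ereal (\<phi> n - ?E n) +
        ereal (w n * lF (x n) y + \<beta> (Suc n) * D y - \<beta> n * (D (z n) + d' (z n) (y - z n)))"
      by (simp del: sum.lessThan_Suc)
    also have "\<dots> \<le> md_model Q f g d d' w \<beta> \<psi> z x n y"
      unfolding md_model_eq[of y z n x \<psi>, OF y zQ xQ] by (rule add_right_mono[OF Suc.IH])
    also have "\<dots> \<le> \<psi> (Suc n) y"
      using aux y by (simp add: auxiliary_property_def)
    finally show "ereal (\<phi> (Suc n) - ?E (Suc n)) \<le> \<psi> (Suc n) y" .
  qed
qed

lemma estimate_sequence_rate:
  assumes aux: "auxiliary_property Q f g d d' x0 w \<beta> \<psi> z x"
    and \<phi>_0: "\<phi> 0 = 0"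
    and \<phi>_Suc: "\<And>n y. y \<in> Q \<Longrightarrow>
      \<phi> (Suc n) + w n * g (x n) (y - z n) \<le> \<phi> n + w n * lF (x n) y"
    and y: "y \<in> Q"
  shows "\<phi> (Suc k) / weight_sum w k - F y \<le>
    (\<beta> (Suc k) * (D (z (Suc k)) + d' (z (Suc k)) (y - z (Suc k)))
      + 1 / (2 * \<sigma>) * (\<Sum>i\<le>k. (w i)\<^sup>2 / \<beta> i * (norm (g (x i)))\<^sup>2)) / weight_sum w k"
proof -
  let ?E = "1 / (2 * \<sigma>) * (\<Sum>i\<le>k. (w i)\<^sup>2 / \<beta> i * (norm (g (x i)))\<^sup>2)"
  let ?l = "D (z (Suc k)) + d' (z (Suc k)) (y - z (Suc k))"
  have zQ: "z n \<in> Q" and xQ: "x n \<in> Q" for n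
    using aux by (auto simp: auxiliary_property_def is_arg_min_def)
  have "ereal (\<phi> (Suc k) - ?E) \<le> (INF u\<in>Q. \<psi> (Suc k) u)"
    using estimate_sequence_le_INF[OF aux \<phi>_0 \<phi>_Suc, of "Suc k"] by (simp only: lessThan_Suc_atMost)
  also have "\<dots> \<le> (INF y\<in>Q. (\<Sum>i\<le>k. ereal (w i) * lin f g (x i) y)
      + ereal (\<beta> (Suc k)) * lin d d' (z (Suc k)) y)"
    using aux by (simp add: auxiliary_property_def)
  also have "\<dots> \<le> (\<Sum>i\<le>k. ereal (w i) * lin f g (x i) y) + ereal (\<beta> (Suc k)) * lin d d' (z (Suc k)) y"
    using y by (rule INF_lower)
  also have "\<dots> = ereal ((\<Sum>i\<le>k. w i * lF (x i) y) + \<beta> (Suc k) * ?l)"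
    by (simp add: lin_f_eq[OF xQ] lin_d_eq[OF zQ])
  finally have "\<phi> (Suc k) - ?E \<le> (\<Sum>i\<le>k. w i * lF (x i) y) + \<beta> (Suc k) * ?l"
    by simp
  also have "(\<Sum>i\<le>k. w i * lF (x i) y) \<le> weight_sum w k * F y"
    unfolding weight_sum_def sum_distrib_right
    using w_pos lF_le[OF xQ y] by (intro sum_mono mult_left_mono) (auto intro: less_imp_le)
  finally have "\<phi> (Suc k) - F y * weight_sum w k \<le> \<beta> (Suc k) * ?l + ?E"
    by (simp add: algebra_simps)
  moreover have "\<phi> (Suc k) / weight_sum w k - F y = (\<phi> (Suc k) - F y * weight_sum w k) / weight_sum w k"
    using weight_sum_pos[of k] by (simp add: field_simps)
  ultimately show ?thesis
    using weight_sum_pos[of k] by (simp add: divide_right_mono)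
qed

section \<open>The two procedures\<close>

lemma weighted_average_in_Q:
  assumes "\<And>i. u i \<in> Q"
  shows "(1 / weight_sum w k) *\<^sub>R (\<Sum>i\<le>k. w i *\<^sub>R u i) \<in> Q"
proof -
  have "(\<Sum>i\<le>k. (w i / weight_sum w k) *\<^sub>R u i) \<in> Q"
    using assms w_pos weight_sum_pos[of k]
    by (intro convex_sum convex_Q)
      (auto simp: weight_sum_def sum_divide_distrib[symmetric] intro!: divide_nonneg_pos less_imp_le)
  then show ?thesis by (simp add: scaleR_sum_right)
qed

text \<open>
  Jensen's inequality, read off from the subgradient at the average: the weighted sum of the
  displacements from the average vanishes.
\<close>

lemma F_weighted_average_le:
  assumes u: "\<And>i. u i \<in> Q" and ubar: "ubar = (1 / weight_sum w k) *\<^sub>R (\<Sum>i\<le>k. w i *\<^sub>R u i)"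
  shows "F ubar \<le> (\<Sum>i\<le>k. w i * F (u i)) / weight_sum w k"
proof -
  have S: "weight_sum w k *\<^sub>R ubar = (\<Sum>i\<le>k. w i *\<^sub>R u i)"
    using weight_sum_pos[of k] by (simp add: ubar)
  have ubarQ: "ubar \<in> Q" unfolding ubar by (rule weighted_average_in_Q[OF u])
  have "(\<Sum>i\<le>k. w i * g ubar (u i - ubar)) = g ubar ((\<Sum>i\<le>k. w i *\<^sub>R u i) - weight_sum w k *\<^sub>R ubar)"
    by (simp add: weight_sum_def blinfun.diff_right blinfun.sum_right blinfun.scaleR_right
        right_diff_distrib sum_subtractf sum_distrib_right)
  then have "(\<Sum>i\<le>k. w i * g ubar (u i - ubar)) = 0" by (simp add: S blinfun.zero_right)
  then have "F ubar * weight_sum w k = (\<Sum>i\<le>k. w i * lF ubar (u i))"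
    by (simp add: lF_def weight_sum_def distrib_left sum.distrib sum_distrib_left mult.commute)
  also have "\<dots> \<le> (\<Sum>i\<le>k. w i * F (u i))"
    using w_pos lF_le[OF ubarQ u] by (intro sum_mono mult_left_mono) (auto intro: less_imp_le)
  finally show ?thesis using weight_sum_pos[of k] by (simp add: field_simps)
qed

lemma procedure_a_rate:
  assumes aux: "auxiliary_property Q f g d d' x0 w \<beta> \<psi> z x"
    and xz: "\<And>n. x n = z n" and y: "y \<in> Q"
  shows "(\<Sum>i\<le>k. w i * F (x i)) / weight_sum w k - F y \<le>
    (\<beta> (Suc k) * (D (z (Suc k)) + d' (z (Suc k)) (y - z (Suc k)))
      + 1 / (2 * \<sigma>) * (\<Sum>i\<le>k. (w i)\<^sup>2 / \<beta> i * (norm (g (x i)))\<^sup>2)) / weight_sum w k"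
proof -
  let ?\<phi> = "\<lambda>n. \<Sum>i<n. w i * F (x i)"
  have "?\<phi> (Suc n) + w n * g (x n) (u - z n) \<le> ?\<phi> n + w n * lF (x n) u" for n u
    by (simp add: lF_def xz distrib_left)
  from estimate_sequence_rate[OF aux _ this y, of k] show ?thesis
    by (simp only: lessThan_Suc_atMost) simp
qed

text \<open>
  The test point \<open>x (Suc n)\<close> is the average of \<open>x n\<close> and \<open>z (Suc n)\<close> with weights \<open>weight_sum w n\<close> and
  \<open>w (Suc n)\<close>.  Bounding \<open>F (x n)\<close> below by the linearization at \<open>x (Suc n)\<close> therefore moves the
  centre of the combined linearization to \<open>z (Suc n)\<close>.
\<close>

lemma procedure_b_rate:
  assumes aux: "auxiliary_property Q f g d d' x0 w \<beta> \<psi> z x"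
    and avg: "\<And>n. x n = (1 / weight_sum w n) *\<^sub>R (\<Sum>i\<le>n. w i *\<^sub>R z i)" and y: "y \<in> Q"
  shows "F (x k) - F y \<le>
    (\<beta> (Suc k) * (D (z (Suc k)) + d' (z (Suc k)) (y - z (Suc k)))
      + 1 / (2 * \<sigma>) * (\<Sum>i\<le>k. (w i)\<^sup>2 / \<beta> i * (norm (g (x i)))\<^sup>2)) / weight_sum w k"
proof -
  let ?\<phi> = "\<lambda>n. case n of 0 \<Rightarrow> 0 | Suc m \<Rightarrow> weight_sum w m * F (x m)"
  have xQ: "x n \<in> Q" for n
    using aux by (simp add: auxiliary_property_def)
  have Sx: "weight_sum w n *\<^sub>R x n = (\<Sum>i\<le>n. w i *\<^sub>R z i)" for n
    using weight_sum_pos[of n] by (simp add: avg)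
  have "?\<phi> (Suc n) + w n * g (x n) (u - z n) \<le> ?\<phi> n + w n * lF (x n) u" for n u
  proof (cases n)
    case 0
    have "x 0 = z 0" using w_pos by (simp add: avg weight_sum_def less_imp_neq[symmetric])
    then show ?thesis by (simp add: 0 weight_sum_def lF_def distrib_left)
  next
    case (Suc m)
    have S: "weight_sum w n = weight_sum w m + w n"
      by (simp add: Suc weight_sum_def)
    have "weight_sum w m *\<^sub>R x m + w n *\<^sub>R z n = weight_sum w n *\<^sub>R x n"
      by (simp add: Sx Suc)
    then have "g (x n) (weight_sum w m *\<^sub>R x m + w n *\<^sub>R z n) = g (x n) (weight_sum w n *\<^sub>R x n)"
      by simp
    then have "weight_sum w m * g (x n) (x m) + w n * g (x n) (z n) = weight_sum w n * g (x n) (x n)"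
      by (simp add: blinfun.add_right blinfun.scaleR_right)
    moreover have "weight_sum w m * lF (x n) (x m) \<le> weight_sum w m * F (x m)"
      using lF_le[OF xQ xQ] weight_sum_pos[of m] by simp
    ultimately show ?thesis
      by (simp add: Suc[symmetric] S lF_def blinfun.diff_right algebra_simps)
        (simp add: Suc algebra_simps)
  qed
  from estimate_sequence_rate[OF aux _ this y, of k] show ?thesis
    using weight_sum_pos[of k] by simp
qed

end

theorem corollary4p3:
  fixes Q :: "'a::real_normed_vector set"
    and f d :: "'a \<Rightarrow> ereal"
    and g d' :: "'a \<Rightarrow> 'a \<Rightarrow>\<^sub>L real"
    and \<sigma> :: real
    and x0 xstar :: 'a
    and w \<beta> :: "nat \<Rightarrow> real"
  assumes finite_dim: "\<exists>B::'a set. finite B \<and> span B = UNIV"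
    and Q: "Q \<noteq> {}" "closed Q" "convex Q"
    and f: "proper f" "lower_semicontinuous f" "convex_fun f" "\<forall>y\<in>Q. f y < \<infinity>"
    and g: "\<forall>y\<in>Q. g y \<in> subdifferential f y"
    and xstar: "argmin_on Q f xstar"
    and d: "prox_function Q \<sigma> d d' x0"
    and w: "\<forall>k. 0 < w k"
    and \<beta>: "\<forall>n. 0 < \<beta> n \<and> \<beta> n \<le> \<beta> (Suc n)"
  shows
    "(\<forall>\<psi> z x gs xhat.
        procedure_a Q g w \<psi> z x gs xhat \<and>
        (standard_construction Q f g d d' w \<beta> \<psi> z x \<or> auxiliary_property Q f g d d' x0 w \<beta> \<psi> z x) \<longrightarrow>
        (\<forall>k. f (xhat k) - f xstar
               \<le> ereal (1 / weight_sum w k) * (\<Sum>i\<le>k. ereal (w i) * f (x i)) - f xstar \<and>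
             ereal (1 / weight_sum w k) * (\<Sum>i\<le>k. ereal (w i) * f (x i)) - f xstar
               \<le> (ereal (\<beta> (Suc k)) * lin d d' (z (Suc k)) xstar
                    + ereal (1 / (2 * \<sigma>) * (\<Sum>i\<le>k. (w i)\<^sup>2 / \<beta> i * (norm (gs i))\<^sup>2)))
                  / ereal (weight_sum w k))) \<and>
     (\<forall>\<psi> z x gs xhat.
        procedure_b Q g w \<psi> z x gs xhat \<and>
        (standard_construction Q f g d d' w \<beta> \<psi> z x \<or> auxiliary_property Q f g d d' x0 w \<beta> \<psi> z x) \<longrightarrow>
        (\<forall>k. f (xhat k) - f xstar
               \<le> (ereal (\<beta> (Suc k)) * lin d d' (z (Suc k)) xstar
                    + ereal (1 / (2 * \<sigma>) * (\<Sum>i\<le>k. (w i)\<^sup>2 / \<beta> i * (norm (gs i))\<^sup>2)))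
                  / ereal (weight_sum w k)))"
  proof -
  interpret subgradient_setting Q \<sigma> d d' x0 f g w \<beta>
    using Q(3) d f(1,4) g w \<beta> by unfold_locales auto
  have xstarQ: "xstar \<in> Q" using xstar by (simp add: is_arg_min_def)
  have divide: "ereal r / ereal (weight_sum w k) = ereal (r / weight_sum w k)" for r k
    using weight_sum_pos[of k] by simp
  show ?thesis
  proof (intro conjI allI impI; elim conjE)
    fix \<psi> z x gs xhat k
    assume proc: "procedure_a Q g w \<psi> z x gs xhat"
      and "standard_construction Q f g d d' w \<beta> \<psi> z x \<or> auxiliary_property Q f g d d' x0 w \<beta> \<psi> z x"
    moreover from proc have z: "argmin_on Q (\<psi> n) (z n)" and xz: "x n = z n"
      and xhat: "xhat n = (1 / weight_sum w n) *\<^sub>R (\<Sum>i\<le>n. w i *\<^sub>R x i)" and gs: "gs n = g (x n)" for n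
      by (auto simp: procedure_a_def)
    moreover have xQ: "x n \<in> Q" for n using z xz by (simp add: is_arg_min_def)
    ultimately have aux: "auxiliary_property Q f g d d' x0 w \<beta> \<psi> z x"
      using standard_construction_auxiliary_property by blast
    have zQ: "z n \<in> Q" for n using z by (simp add: is_arg_min_def)
    have xhatQ: "xhat k \<in> Q" unfolding xhat by (rule weighted_average_in_Q[OF xQ])
    show "f (xhat k) - f xstar
        \<le> ereal (1 / weight_sum w k) * (\<Sum>i\<le>k. ereal (w i) * f (x i)) - f xstar"
      using F_weighted_average_le[OF xQ xhat, of k]
      by (simp add: f_eq[OF xQ] f_eq[OF xhatQ] f_eq[OF xstarQ])
    show "ereal (1 / weight_sum w k) * (\<Sum>i\<le>k. ereal (w i) * f (x i)) - f xstar
        \<le> (ereal (\<beta> (Suc k)) * lin d d' (z (Suc k)) xstar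
             + ereal (1 / (2 * \<sigma>) * (\<Sum>i\<le>k. (w i)\<^sup>2 / \<beta> i * (norm (gs i))\<^sup>2)))
           / ereal (weight_sum w k)"
      using procedure_a_rate[OF aux xz xstarQ, of k]
      by (simp add: f_eq[OF xQ] f_eq[OF xstarQ] lin_d_eq[OF zQ] gs divide del: ereal_divide)
  next
    fix \<psi> z x gs xhat k
    assume proc: "procedure_b Q g w \<psi> z x gs xhat"
      and "standard_construction Q f g d d' w \<beta> \<psi> z x \<or> auxiliary_property Q f g d d' x0 w \<beta> \<psi> z x"
    moreover from proc have z: "argmin_on Q (\<psi> n) (z n)"
      and avg: "x n = (1 / weight_sum w n) *\<^sub>R (\<Sum>i\<le>n. w i *\<^sub>R z i)"
      and xhat: "xhat n = x n" and gs: "gs n = g (x n)" for n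
      by (auto simp: procedure_b_def)
    moreover have zQ: "z n \<in> Q" for n using z by (simp add: is_arg_min_def)
    moreover have xQ: "x n \<in> Q" for n unfolding avg by (rule weighted_average_in_Q[OF zQ])
    moreover have "x 0 = z 0" using w by (simp add: avg weight_sum_def less_imp_neq[symmetric])
    ultimately have aux: "auxiliary_property Q f g d d' x0 w \<beta> \<psi> z x"
      using standard_construction_auxiliary_property by blast
    show "f (xhat k) - f xstar
        \<le> (ereal (\<beta> (Suc k)) * lin d d' (z (Suc k)) xstar
             + ereal (1 / (2 * \<sigma>) * (\<Sum>i\<le>k. (w i)\<^sup>2 / \<beta> i * (norm (gs i))\<^sup>2)))
           / ereal (weight_sum w k)"
      using procedure_b_rate[OF aux avg xstarQ, of k]
      by (simp add: xhat f_eq[OF xQ] f_eq[OF xstarQ] lin_d_eq[OF zQ] gs divide del: ereal_divide)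
  qed
qed

end
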